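(* Let $n$ be a positive integer and let $k$ be a positive integer not divisible by $3$. Let $m=\prod_{p\in\Pi_2}p^{\nu_p(k)}$ be the product, counted with multiplicity, of the prime factors of $k$ with residue $2$ modulo $3$. Assume that $m$ is a square. Then $$a_3\left(kn+\frac{k-1}3\right)=a_3(n)\prod_{p\in\Pi_1}\frac{\nu_p(k)+\nu_p(3n+1)+1}{\nu_p(3n+1)+1}.$$
   Context: $a_3(n)$ denotes the number of $3$-core partitions of $n$, i.e. integer partitions of $n$ whose Young diagram has no hook of length $3$ (the hook of a box $b$ consists of $b$, the boxes to its right in its row and the boxes below it in its column; its hooklength is its number of boxes). $\Pi_1$ and $\Pi_2$ are the sets of prime numbers congruent to $1$, respectively $2$, modulo $3$, and $\nu_p$ is the $p$-adic valuation. Under the hypotheses $k\equiv1\bmod 3$, so $kn+\frac{k-1}{3}$ is an integer. *)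

theory Defs
  imports Complex_Main "HOL-Computational_Algebra.Computational_Algebra"
begin

text \<open>A partition is the weakly decreasing list of its positive parts. Boxes of its Young
  diagram are pairs (row, column), both counted from 0.\<close>

definition partitions :: "nat \<Rightarrow> nat list set" where
  "partitions n = {xs. sorted_wrt (\<ge>) xs \<and> 0 \<notin> set xs \<and> sum_list xs = n}"

definition young_diagram :: "nat list \<Rightarrow> (nat \<times> nat) set" where
  "young_diagram xs = {(i, j). i < length xs \<and> j < xs ! i}"

definition hook :: "nat list \<Rightarrow> nat \<times> nat \<Rightarrow> (nat \<times> nat) set" where
  "hook xs b = {b}
     \<union> {(i, j) \<in> young_diagram xs. i = fst b \<and> j > snd b}
     \<union> {(i, j) \<in> young_diagram xs. i > fst b \<and> j = snd b}"

definition hook_length :: "nat list \<Rightarrow> nat \<times> nat \<Rightarrow> nat" where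
  "hook_length xs b = card (hook xs b)"

definition is_core :: "nat \<Rightarrow> nat list \<Rightarrow> bool" where
  "is_core t xs \<longleftrightarrow> (\<forall>b \<in> young_diagram xs. hook_length xs b \<noteq> t)"

definition num_cores :: "nat \<Rightarrow> nat \<Rightarrow> nat" where
  "num_cores t n = card {xs \<in> partitions n. is_core t xs}"

text \<open>No junk values: \<^const>\<open>card\<close> is only applied to finite sets.\<close>

lemma finite_partitions: "finite (partitions n)"
proof -
  have "length xs \<le> sum_list xs" if "0 \<notin> set xs" for xs :: "nat list"
    using that by (induction xs) auto
  then have "partitions n \<subseteq> {xs. set xs \<subseteq> {..n} \<and> length xs \<le> n}"
    by (auto simp: partitions_def intro: member_le_sum_list)
  then show ?thesis
    using finite_lists_length_le[of "{..n}" n] finite_subset by blast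
qed

lemma finite_young_diagram: "finite (young_diagram xs)"
proof -
  have "young_diagram xs = (SIGMA i:{..<length xs}. {..<xs ! i})"
    by (auto simp: young_diagram_def)
  then show ?thesis by simp
qed

lemma finite_hook: "finite (hook xs b)"
proof -
  have "hook xs b \<subseteq> insert b (young_diagram xs)"
    by (auto simp: hook_def)
  then show ?thesis
    using finite_young_diagram finite_subset by blast
qed

definition primes_mod3 :: "nat \<Rightarrow> nat set" where
  "primes_mod3 r = {p. prime p \<and> p mod 3 = r}"

text \<open>Products over these infinite sets of primes are taken with \<^const>\<open>prod'\<close>, which
  multiplies the factors different from 1; an ordinary \<^const>\<open>prod\<close> over an infinite set
  would be 1 by convention. The next two lemmas show that the supports are finite.\<close>

definition part2 :: "nat \<Rightarrow> nat" where
  "part2 k = prod' (\<lambda>p. p ^ multiplicity p k) (primes_mod3 2)"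

lemma finite_support_part2:
  assumes "k > 0"
  shows "finite {p \<in> primes_mod3 2. p ^ multiplicity p k \<noteq> 1}"
proof (rule finite_subset)
  show "{p \<in> primes_mod3 2. p ^ multiplicity p k \<noteq> 1} \<subseteq> prime_factors k"
    using assms by (auto simp: primes_mod3_def prime_factors_multiplicity)
qed simp

lemma finite_support_ratio:
  assumes "k > 0"
  shows "finite {p \<in> primes_mod3 1.
    real (multiplicity p k + multiplicity p (3 * n + 1) + 1) /
    real (multiplicity p (3 * n + 1) + 1) \<noteq> 1}"
proof (rule finite_subset)
  show "{p \<in> primes_mod3 1.
    real (multiplicity p k + multiplicity p (3 * n + 1) + 1) /
    real (multiplicity p (3 * n + 1) + 1) \<noteq> 1} \<subseteq> prime_factors k"
    using assms by (auto simp: primes_mod3_def prime_factors_multiplicity)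
qed simp

text \<open>The truncating \<^term>\<open>(k - 1) div 3\<close> on naturals is therefore exact when
  \<^term>\<open>part2 k\<close> is a square.\<close>

lemma mod3_eq_1:
  assumes "k > 0" "\<not> 3 dvd k" "is_square (part2 k)"
  shows "k mod 3 = 1"
proof -
  define A where "A = {p \<in> prime_factors k. p mod 3 = 1}"
  define B where "B = {p \<in> prime_factors k. p mod 3 = 2}"
  define f where "f = (\<lambda>p. p ^ multiplicity p k)"
  have fin: "finite A" "finite B" by (auto simp: A_def B_def)
  have "p mod 3 = 1 \<or> p mod 3 = 2" if "p \<in> prime_factors k" for p
  proof -
    have "p mod 3 \<noteq> 0"
      using that assms(2) by (metis dvd_trans in_prime_factors_iff mod_0_imp_dvd)
    then show ?thesis by linarith
  qed
  then have un: "prime_factors k = A \<union> B" by (auto simp: A_def B_def)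
  have "k = prod f (prime_factors k)"
    using assms(1) by (simp add: f_def prime_factorization_nat)
  also have "\<dots> = prod f A * prod f B"
    unfolding un by (rule prod.union_disjoint) (auto simp: fin A_def B_def)
  finally have k: "k = prod f A * prod f B" .
  have supp: "{p \<in> primes_mod3 2. f p \<noteq> 1} = B"
    using assms(1) by (auto simp: primes_mod3_def B_def f_def prime_factors_multiplicity)
  have B: "prod f B = part2 k"
    using fin supp unfolding part2_def prod.G_def f_def by simp
  obtain r where r: "prod f B = r ^ 2"
    using assms(3) B by (auto elim: is_nth_powerE)
  have "f p mod 3 = 1" if "p \<in> A" for p
    using that power_mod[of p 3] by (simp add: A_def f_def)
  then have "(\<Prod>p\<in>A. f p mod 3) = 1" by simp
  then have A: "prod f A mod 3 = 1"
    using mod_prod_eq[of f 3 A] by simp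
  have "r mod 3 \<noteq> 0"
    using assms(2) k r by (metis dvd_mult dvd_power mod_0_imp_dvd pos2 dvd_trans)
  then have "r mod 3 = 1 \<or> r mod 3 = 2" by linarith
  then have "r ^ 2 mod 3 = 1"
    by (auto simp: power2_eq_square mod_mult_eq[of r 3 r, symmetric])
  then show ?thesis
    using A k r by (metis mod_mult_eq mult_1 mod_mod_trivial)
qed

end

theory Submission
  imports Defs "HOL-Library.Discrete_Functions" "HOL-Number_Theory.Residue_Primitive_Roots"
begin

text \<open>A partition is determined by its beta set, the set of the hook lengths of its first
  column. A hook of length t corresponds to an element b of the beta set such that b - t is a
  natural number outside it, so the partition is a 3-core iff its beta set is closed under
  subtraction of 3. As 0 never belongs to it, it consists of the first u numbers congruent to 1
  modulo 3 and the first v numbers congruent to 2, and the size of the partition is then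
  \<open>u\<^sup>2 + v\<^sup>2 + v - u * v\<close> (\<open>num_cores_3_eq\<close>).

  Three times this number plus 1 is the norm \<open>a\<^sup>2 - a * b + b\<^sup>2\<close> of an Eisenstein
  integer \<open>a + b * \<omega>\<close> lying in a sector of 120 degrees and having a prescribed one of the
  two nonzero residues modulo \<open>1 - \<omega>\<close>. Rotation by \<open>\<omega>\<close> and negation spread these over all
  elements of norm \<open>3 * n + 1\<close>; so the number \<open>r (3 * n + 1)\<close> of these elements is six times the
  number of 3-cores of n (\<open>card_norm_set_num_cores\<close>).

  As \<open>k * (3 * n + 1) = 3 * (k * n + (k - 1) / 3) + 1\<close>, it remains to see how r changes when its
  argument is multiplied by k, one prime factor at a time. A prime \<open>p\<close> congruent to 2 modulo 3
  is inert: it divides every element whose norm it divides, hence \<open>r (p\<^sup>2 * N) = r N\<close>. Since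
  part2 k is a square, these primes come in pairs and leave r unchanged. A prime p congruent
  to 1 is the norm of some \<open>\<pi>\<close>, and the elements of norm \<open>p * N\<close> are the multiples of \<open>\<pi>\<close> or of its
  conjugate by elements of norm N. The multiples of both are the multiples of p, and
  inclusion-exclusion gives \<open>r (p * N) + r (N / p) = 2 * r N\<close>, where \<open>r (N / p) = 0\<close> if p does not
  divide N. Hence \<open>r (p ^ e * M)\<close> is \<open>(e + 1) * r M\<close> for M prime to p: each factor p multiplies
  r by \<open>(e + 2) / (e + 1)\<close>, and the product of these ratios telescopes to the stated one.\<close>

section \<open>Beta sets and hook lengths\<close>

definition is_partition :: "nat list \<Rightarrow> bool" where
  "is_partition xs \<longleftrightarrow> sorted_wrt (\<ge>) xs \<and> 0 \<notin> set xs"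

text \<open>Because the lists are weakly decreasing, the new first row contributes the largest
  element; this lets maxima and inductions on sets match the recursion on lists.\<close>

fun beta_set :: "nat list \<Rightarrow> nat set" where
  "beta_set [] = {}"
| "beta_set (x # xs) = insert (x + length xs) (beta_set xs)"

lemma is_partition_Nil [simp]: "is_partition []"
  by (simp add: is_partition_def)

lemma is_partition_Cons:
  "is_partition (x # xs) \<longleftrightarrow> 0 < x \<and> (\<forall>y \<in> set xs. y \<le> x) \<and> is_partition xs"
  by (auto simp: is_partition_def)

lemma finite_beta_set [simp]: "finite (beta_set xs)"
  by (induction xs) auto

lemma beta_set_less:
  assumes "is_partition (x # xs)" "b \<in> beta_set xs"
  shows "b < x + length xs"
  using assms by (induction xs arbitrary: x) (fastforce simp: is_partition_Cons)+

lemma zero_notin_beta_set: "is_partition xs \<Longrightarrow> 0 \<notin> beta_set xs"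
  by (induction xs) (auto simp: is_partition_Cons)

lemma card_beta_set: "is_partition xs \<Longrightarrow> card (beta_set xs) = length xs"
proof (induction xs)
  case (Cons x xs)
  then show ?case
    using beta_set_less[OF Cons.prems] by (auto simp: is_partition_Cons card_insert_if)
qed simp

lemma sum_beta_set:
  "is_partition xs \<Longrightarrow> 2 * \<Sum>(beta_set xs) + length xs = 2 * sum_list xs + (length xs)\<^sup>2"
proof (induction xs)
  case (Cons x xs)
  have "x + length xs \<notin> beta_set xs"
    using beta_set_less[OF Cons.prems] by blast
  with Cons show ?case
    by (simp add: is_partition_Cons power2_eq_square algebra_simps)
qed simp

lemma Max_beta_set:
  assumes "is_partition (x # xs)"
  shows "Max (beta_set (x # xs)) = x + length xs"
  using beta_set_less[OF assms] by (intro Max_eqI) (auto intro: less_imp_le)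

lemma beta_set_inject:
  assumes "is_partition xs" "is_partition ys" "beta_set xs = beta_set ys"
  shows "xs = ys"
  using assms
proof (induction xs arbitrary: ys)
  case Nil
  then show ?case by (cases ys) auto
next
  case (Cons x xs)
  then obtain y zs where ys: "ys = y # zs" by (cases ys) auto
  have max: "x + length xs = y + length zs"
    using Max_beta_set Cons.prems unfolding ys by metis
  have "x + length xs \<notin> beta_set xs" "y + length zs \<notin> beta_set zs"
    using beta_set_less Cons.prems unfolding ys by blast+
  then have "beta_set xs = beta_set zs"
    using Cons.prems(3) max unfolding ys by (auto simp: insert_ident)
  then have "xs = zs"
    using Cons.IH Cons.prems unfolding ys by (auto simp: is_partition_Cons)
  then show ?case using max ys by simp
qed

text \<open>The list is rebuilt from the largest element downwards: if b exceeds all elements of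
  the beta set of a partition with l parts, then b - l is at least the largest part.\<close>

lemma beta_set_surj:
  assumes "finite B" "0 \<notin> B"
  shows "\<exists>xs. is_partition xs \<and> beta_set xs = B"
  using assms
proof (induction B rule: finite_linorder_max_induct)
  case empty
  have "is_partition [] \<and> beta_set [] = {}" by simp
  then show ?case by blast
next
  case (insert b B)
  then obtain xs where xs: "is_partition xs" "beta_set xs = B" by auto
  have "length xs < b \<and> (\<forall>y \<in> set xs. y + length xs \<le> b)"
  proof (cases xs)
    case Nil
    then show ?thesis using insert.prems by simp
  next
    case (Cons z zs)
    then have "z + length zs < b" using insert.hyps xs by auto
    then show ?thesis using Cons xs(1) by (auto simp: is_partition_Cons)
  qed
  then have "is_partition ((b - length xs) # xs)" "beta_set ((b - length xs) # xs) = insert b B"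
    using xs by (auto simp: is_partition_Cons)
  then show ?case by blast
qed

lemma less_length_filter_iff:
  assumes "is_partition xs" "i < length xs"
  shows "i < length (filter (\<lambda>y. j < y) xs) \<longleftrightarrow> j < xs ! i"
  using assms
proof (induction xs arbitrary: i)
  case (Cons x xs)
  show ?case
  proof (cases "j < x")
    case True
    then show ?thesis using Cons by (cases i) (auto simp: is_partition_Cons)
  next
    case False
    then have "\<not> j < y" if "y \<in> set (x # xs)" for y
      using that Cons.prems by (auto simp: is_partition_Cons)
    moreover have "(x # xs) ! i \<in> set (x # xs)" using Cons.prems by (intro nth_mem)
    ultimately show ?thesis
      by (metis (no_types, lifting) filter_False less_nat_zero_code list.size(3))
  qed
qed simp

abbreviation shift_down :: "nat \<times> nat \<Rightarrow> nat \<times> nat" where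
  "shift_down \<equiv> map_prod Suc id"

lemma mem_shift_down_image:
  "(i, j) \<in> shift_down ` A \<longleftrightarrow> (\<exists>i'. i = Suc i' \<and> (i', j) \<in> A)"
  by force

lemma inj_shift_down: "inj_on shift_down A"
  by (auto simp: inj_on_def)

lemma mem_hook:
  "(i', j') \<in> hook xs (i, j) \<longleftrightarrow>
     i' = i \<and> j' = j \<or>
     i' < length xs \<and> j' < xs ! i' \<and> (i' = i \<and> j < j' \<or> i < i' \<and> j' = j)"
  by (auto simp: hook_def young_diagram_def)

lemma hook_length_Suc: "hook_length (x # xs) (Suc i, j) = hook_length xs (i, j)"
proof -
  have "c \<in> hook (x # xs) (Suc i, j) \<longleftrightarrow> c \<in> shift_down ` hook xs (i, j)" for c
    by (cases c; cases "fst c")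
      (auto simp: mem_hook mem_shift_down_image)
  then have "hook (x # xs) (Suc i, j) = shift_down ` hook xs (i, j)"
    by blast
  then show ?thesis
    by (simp add: hook_length_def card_image inj_shift_down)
qed

lemma hook_length_shift_down: "hook_length (x # xs) (shift_down b) = hook_length xs b"
  by (cases b) (simp add: hook_length_Suc)

lemma hook_length_0:
  assumes "j < x"
  shows "hook_length (x # xs) (0, j) = x - j + length (filter (\<lambda>y. j < y) xs)"
proof -
  let ?I = "{i. i < length xs \<and> j < xs ! i}"
  have "hook (x # xs) (0, j) = Pair 0 ` {j..<x} \<union> (\<lambda>i. (Suc i, j)) ` ?I"
  proof (intro equalityI subsetI)
    fix c assume "c \<in> hook (x # xs) (0, j)"
    moreover obtain i' j' where "c = (i', j')" by force
    ultimately show "c \<in> Pair 0 ` {j..<x} \<union> (\<lambda>i. (Suc i, j)) ` ?I"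
      using assms by (cases i') (auto simp: hook_def young_diagram_def image_iff)
  qed (use assms in \<open>auto simp: hook_def young_diagram_def\<close>)
  moreover have "card (Pair (0::nat) ` {j..<x}) = x - j"
    by (subst card_image) (auto simp: inj_on_def)
  moreover have "card ((\<lambda>i. (Suc i, j)) ` ?I) = card ?I"
    by (rule card_image) (auto simp: inj_on_def)
  moreover have "card (Pair 0 ` {j..<x} \<union> (\<lambda>i. (Suc i, j)) ` ?I) =
      card (Pair (0::nat) ` {j..<x}) + card ((\<lambda>i. (Suc i, j)) ` ?I)"
    by (rule card_Un_disjoint) auto
  ultimately show ?thesis
    by (simp add: hook_length_def length_filter_conv_card)
qed

lemma beta_set_nth:
  "b \<in> beta_set xs \<longleftrightarrow> (\<exists>i < length xs. b = xs ! i + (length xs - 1 - i))"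
proof (induction xs)
  case (Cons x xs)
  then show ?case by (auto simp: less_Suc_eq_0_disj)
qed simp

text \<open>The hook length of column j is x - j plus the number c of lower rows longer than j. If
  it were m - b, where b comes from the lower row i of length y, then c - i - 1 = j - y. But i < c
  iff j < y, so one side is negative exactly when the other is not. Both families are injective
  and together they have m members of \<open>{1..m}\<close>, so each is the complement of the other.\<close>

lemma first_row_hook_lengths:
  assumes "is_partition (x # xs)"
  defines "m \<equiv> x + length xs"
  shows "(\<lambda>j. hook_length (x # xs) (0, j)) ` {..<x} = {1..m} - (\<lambda>b. m - b) ` beta_set xs"
proof -
  define c where "c j = length (filter (\<lambda>y. j < y) xs)" for j
  define h where "h j = x - j + c j" for j
  have part: "is_partition xs" using assms by (simp add: is_partition_Cons)
  have lt: "b < m" if "b \<in> beta_set xs" for b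
    using beta_set_less[OF assms(1)] that by (simp add: m_def)
  have mono: "c j \<le> c i" if "i \<le> j" for i j
    using that unfolding c_def
    by (induction xs) auto
  have inj: "inj_on h {..<x}"
  proof (rule linorder_inj_onI')
    fix i j assume "i \<in> {..<x}" "j \<in> {..<x}" "i < j"
    then show "h i \<noteq> h j" using mono[of i j] by (simp add: h_def)
  qed
  have sub: "h ` {..<x} \<subseteq> {1..m}"
  proof -
    have "1 \<le> h j \<and> h j \<le> m" if "j < x" for j
    proof -
      have "c j \<le> length xs" by (simp add: c_def)
      then show ?thesis using that unfolding h_def m_def by linarith
    qed
    then show ?thesis by auto
  qed
  have disj: "h ` {..<x} \<inter> (\<lambda>b. m - b) ` beta_set xs = {}"
  proof -
    have False if j: "j < x" and b: "b \<in> beta_set xs" and eq: "h j = m - b" for j b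
    proof -
      obtain i where i: "i < length xs" "b = xs ! i + (length xs - 1 - i)"
        using b by (auto simp: beta_set_nth)
      have "i < c j \<longleftrightarrow> j < xs ! i"
        unfolding c_def by (rule less_length_filter_iff[OF part i(1)])
      then show False
        using i j eq lt[OF b] by (cases "j < xs ! i") (auto simp: h_def m_def)
    qed
    then show ?thesis by blast
  qed
  have "inj_on (\<lambda>b. m - b) (beta_set xs)"
  proof (rule inj_onI)
    fix a b assume "a \<in> beta_set xs" "b \<in> beta_set xs" "m - a = m - b"
    then show "a = b" using lt[of a] lt[of b] by linarith
  qed
  then have "card ({1..m} - (\<lambda>b. m - b) ` beta_set xs) = x"
    using lt by (subst card_Diff_subset)
      (auto simp: card_image card_beta_set[OF part] m_def Suc_le_eq)
  then have "h ` {..<x} = {1..m} - (\<lambda>b. m - b) ` beta_set xs"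
    using sub disj by (intro card_subset_eq) (auto simp: card_image[OF inj])
  moreover have "(\<lambda>j. hook_length (x # xs) (0, j)) ` {..<x} = h ` {..<x}"
    by (intro image_cong) (auto simp: hook_length_0 h_def c_def)
  ultimately show ?thesis by simp
qed

lemma is_core_Cons:
  "is_core t (x # xs) \<longleftrightarrow>
     is_core t xs \<and> t \<notin> (\<lambda>j. hook_length (x # xs) (0, j)) ` {..<x}"
proof -
  have "c \<in> young_diagram (x # xs) \<longleftrightarrow>
      c \<in> Pair 0 ` {..<x} \<union> shift_down ` young_diagram xs" for c
    by (cases c; cases "fst c")
      (auto simp: young_diagram_def mem_shift_down_image)
  then have "young_diagram (x # xs) = Pair 0 ` {..<x} \<union> shift_down ` young_diagram xs"
    by blast
  then show ?thesis
    by (auto simp: is_core_def ball_Un hook_length_shift_down)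
qed

text \<open>For the bottom rows this is the induction hypothesis. The top row adds the condition on
  the new maximum m of the beta set; for the older elements b the enlarged set changes nothing,
  because b - t differs from m.\<close>

lemma is_core_iff_beta_set:
  assumes "is_partition xs" "t > 0"
  shows "is_core t xs \<longleftrightarrow> (\<forall>b \<in> beta_set xs. t \<le> b \<longrightarrow> b - t \<in> beta_set xs)"
  using assms(1)
proof (induction xs)
  case Nil
  then show ?case by (simp add: is_core_def young_diagram_def)
next
  case (Cons x xs)
  define m where "m = x + length xs"
  have lt: "b < m" if "b \<in> beta_set xs" for b
    using beta_set_less[OF Cons.prems] that by (simp add: m_def)
  have "t \<notin> (\<lambda>j. hook_length (x # xs) (0, j)) ` {..<x} \<longleftrightarrow> (t \<le> m \<longrightarrow> m - t \<in> beta_set xs)"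
    unfolding first_row_hook_lengths[OF Cons.prems] m_def[symmetric]
    using assms(2) lt by (force simp: image_iff dest: less_imp_le)
  moreover have "beta_set (x # xs) = insert m (beta_set xs)" by (simp add: m_def)
  moreover have "b - t \<noteq> m" if "t \<le> b" "b \<in> insert m (beta_set xs)" for b
    using that lt[of b] assms(2) by auto
  moreover have "is_core t xs \<longleftrightarrow> (\<forall>b \<in> beta_set xs. t \<le> b \<longrightarrow> b - t \<in> beta_set xs)"
    using Cons by (simp add: is_partition_Cons)
  ultimately show ?case unfolding is_core_Cons by auto
qed

text \<open>On an abacus with three runners these are the first u positions of runner 1 and the first
  v of runner 2. Runner 0 is empty because 0 is not a first-column hook length.\<close>

definition runners :: "nat \<Rightarrow> nat \<Rightarrow> nat set" where
  "runners u v = (\<lambda>i. 3 * i + 1) ` {..<u} \<union> (\<lambda>i. 3 * i + 2) ` {..<v}"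

lemma mem_runners:
  "b \<in> runners u v \<longleftrightarrow> b mod 3 = 1 \<and> b div 3 < u \<or> b mod 3 = 2 \<and> b div 3 < v"
proof -
  have "b \<in> (\<lambda>i. 3 * i + r) ` {..<w} \<longleftrightarrow> b mod 3 = r \<and> b div 3 < w" if "r < 3" for r w
  proof
    assume "b mod 3 = r \<and> b div 3 < w"
    then show "b \<in> (\<lambda>i. 3 * i + r) ` {..<w}" 
      by (intro image_eqI[of _ _ "b div 3"]) auto
  qed (use that in auto)
  from this[of 1] this[of 2] show ?thesis by (auto simp: runners_def)
qed

lemma finite_runners: "finite (runners u v)"
  by (simp add: runners_def)

lemma residues_mem_runners:
  "3 * i \<notin> runners u v"
  "3 * i + 1 \<in> runners u v \<longleftrightarrow> i < u"
  "3 * i + 2 \<in> runners u v \<longleftrightarrow> i < v"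
proof -
  have "(3 * i) mod 3 = 0" "(3 * i + 1) mod 3 = 1" "(3 * i + 1) div 3 = i"
    "(3 * i + 2) mod 3 = 2" "(3 * i + 2) div 3 = i" by presburger+
  then show "3 * i \<notin> runners u v" "3 * i + 1 \<in> runners u v \<longleftrightarrow> i < u"
      "3 * i + 2 \<in> runners u v \<longleftrightarrow> i < v"
    unfolding mem_runners by simp_all
qed

lemma runners_inject: "runners u v = runners u' v' \<longleftrightarrow> u = u' \<and> v = v'"
proof
  assume "runners u v = runners u' v'"
  then have "i < u \<longleftrightarrow> i < u'" "i < v \<longleftrightarrow> i < v'" for i
    using residues_mem_runners[of i u v] residues_mem_runners[of i u' v'] by simp_all
  then show "u = u' \<and> v = v'"
    by (metis less_irrefl linorder_neqE_nat)
qed simp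

lemma card_runners: "card (runners u v) = u + v"
  and sum_runners: "2 * \<Sum>(runners u v) + u + v = 3 * u\<^sup>2 + 3 * v\<^sup>2 + 2 * v"
proof -
  have disj: "(\<lambda>i::nat. 3 * i + 1) ` {..<u} \<inter> (\<lambda>i. 3 * i + 2) ` {..<v} = {}"
    by (auto simp: disjoint_iff) presburger
  have inj: "inj_on (\<lambda>i::nat. 3 * i + r) A" for r A by (auto simp: inj_on_def)
  show "card (runners u v) = u + v"
    unfolding runners_def by (subst card_Un_disjoint[OF _ _ disj])
      (simp_all only: card_image[OF inj] finite_imageI finite_lessThan card_lessThan)
  have 1: "2 * (\<Sum>i<u. 3 * i + 1) + u = 3 * u\<^sup>2"
    by (induction u) (auto simp: power2_eq_square)
  have 2: "2 * (\<Sum>i<v. 3 * i + 2) + v = 3 * v\<^sup>2 + 2 * v"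
    by (induction v) (auto simp: power2_eq_square)
  have "\<Sum>(runners u v) = (\<Sum>i<u. 3 * i + 1) + (\<Sum>i<v. 3 * i + 2)"
    unfolding runners_def
    by (subst sum.union_disjoint[OF _ _ disj])
      (simp_all only: sum.reindex[OF inj] o_def finite_imageI finite_lessThan)
  then show "2 * \<Sum>(runners u v) + u + v = 3 * u\<^sup>2 + 3 * v\<^sup>2 + 2 * v"
    using 1 2 by linarith
qed

lemma residue_class_initial:
  fixes B :: "nat set"
  assumes "finite B" and closed: "\<And>b. b \<in> B \<Longrightarrow> 3 \<le> b \<Longrightarrow> b - 3 \<in> B"
  obtains w where "\<And>i. 3 * i + r \<in> B \<longleftrightarrow> i < w"
proof -
  have down: "3 * i + r \<in> B" if "3 * (i + d) + r \<in> B" for i d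
    using that
  proof (induction d)
    case (Suc d)
    then show ?case using closed[OF Suc.prems] by (simp add: algebra_simps)
  qed simp
  define I where "I = {i. 3 * i + r \<in> B}"
  have "finite ((\<lambda>i. 3 * i + r) -` B)"
    by (intro finite_vimageI assms) (auto simp: inj_on_def)
  then have fin: "finite I" by (simp add: I_def vimage_def)
  define w where "w = (LEAST i. i \<notin> I)"
  have "\<exists>i. i \<notin> I" using fin ex_new_if_finite infinite_UNIV_nat by blast
  then have w: "w \<notin> I" unfolding w_def by (rule LeastI_ex)
  have less_w: "i \<in> I" if "i < w" for i
    using not_less_Least[of i "\<lambda>i. i \<notin> I"] that unfolding w_def by blast
  have "i \<notin> I" if "w \<le> i" for i
    using that w down[of w "i - w"] by (auto simp: I_def)
  then have "3 * i + r \<in> B \<longleftrightarrow> i < w" for i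
    using less_w[of i] by (cases "i < w") (auto simp: I_def)
  then show ?thesis by (rule that)
qed

lemma closed_eq_runners:
  assumes "finite B" "0 \<notin> B" and closed: "\<And>b. b \<in> B \<Longrightarrow> 3 \<le> b \<Longrightarrow> b - 3 \<in> B"
  shows "\<exists>u v. B = runners u v"
proof -
  obtain w where w: "\<And>i. 3 * i + 0 \<in> B \<longleftrightarrow> i < w"
    using residue_class_initial[OF assms(1) closed, of 0] by auto
  obtain u where u: "\<And>i. 3 * i + 1 \<in> B \<longleftrightarrow> i < u"
    using residue_class_initial[OF assms(1) closed, of 1] by auto
  obtain v where v: "\<And>i. 3 * i + 2 \<in> B \<longleftrightarrow> i < v"
    using residue_class_initial[OF assms(1) closed, of 2] by auto
  have "w = 0" using w[of 0] assms(2) by simp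
  have "b \<in> B \<longleftrightarrow> b \<in> runners u v" for b
  proof -
    have "b = 3 * (b div 3) \<or> b = 3 * (b div 3) + 1 \<or> b = 3 * (b div 3) + 2" by presburger
    then obtain i where "b = 3 * i \<or> b = 3 * i + 1 \<or> b = 3 * i + 2" by blast
    then show ?thesis
    proof (elim disjE)
      assume b: "b = 3 * i"
      show ?thesis using w[of i] \<open>w = 0\<close> residues_mem_runners(1)[of i u v] unfolding b by simp
    next
      assume b: "b = 3 * i + 1"
      show ?thesis unfolding b u residues_mem_runners by (rule refl)
    next
      assume b: "b = 3 * i + 2"
      show ?thesis unfolding b v residues_mem_runners by (rule refl)
    qed
  qed
  then show ?thesis by blast
qed

lemma num_cores_3_eq:
  "num_cores 3 n = card {(u, v). u\<^sup>2 + v\<^sup>2 + v = n + u * v}"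
proof -
  define C where "C = {xs \<in> partitions n. is_core 3 xs}"
  define P :: "(nat \<times> nat) set" where "P = {(u, v). u\<^sup>2 + v\<^sup>2 + v = n + u * v}"
  have C: "xs \<in> C \<longleftrightarrow> is_partition xs \<and> sum_list xs = n \<and> is_core 3 xs" for xs
    by (auto simp: C_def partitions_def is_partition_def)
  have size: "sum_list xs = n \<longleftrightarrow> (u, v) \<in> P"
    if "is_partition xs" "beta_set xs = runners u v" for xs u v
  proof -
    have "length xs = u + v"
      using card_beta_set[OF that(1)] by (simp add: that(2) card_runners)
    then have "2 * \<Sum>(runners u v) + (u + v) = 2 * sum_list xs + (u + v)\<^sup>2"
      using sum_beta_set[OF that(1)] by (simp add: that(2))
    then have "u\<^sup>2 + v\<^sup>2 + v = sum_list xs + u * v"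
      using sum_runners[of u v] by (simp add: power2_eq_square algebra_simps)
    then show ?thesis by (auto simp: P_def)
  qed
  have "beta_set ` C = (\<lambda>(u, v). runners u v) ` P"
  proof (intro equalityI subsetI)
    fix B assume "B \<in> beta_set ` C"
    then obtain xs where xs: "xs \<in> C" "B = beta_set xs" by blast
    then have part: "is_partition xs" and core: "is_core 3 xs" and n: "sum_list xs = n"
      by (auto simp: C)
    have "\<forall>b \<in> beta_set xs. 3 \<le> b \<longrightarrow> b - 3 \<in> beta_set xs"
      using core is_core_iff_beta_set[OF part, of 3] by simp
    then obtain u v where uv: "beta_set xs = runners u v"
      using closed_eq_runners[OF finite_beta_set zero_notin_beta_set[OF part]] by blast
    then show "B \<in> (\<lambda>(u, v). runners u v) ` P"
      using size[OF part uv] n xs(2) by (intro image_eqI[of _ _ "(u, v)"]) auto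
  next
    fix B assume "B \<in> (\<lambda>(u, v). runners u v) ` P"
    then obtain u v where uv: "(u, v) \<in> P" "B = runners u v" by auto
    obtain xs where xs: "is_partition xs" "beta_set xs = B"
      using beta_set_surj[of "runners u v"] residues_mem_runners(1)[of 0 u v] finite_runners
      unfolding uv(2) by auto
    have "b - 3 \<in> B" if "b \<in> B" "3 \<le> b" for b
    proof -
      have "(b - 3) mod 3 = b mod 3" using that(2) by (simp add: le_mod_geq)
      moreover have "(b - 3) div 3 \<le> b div 3" by (intro div_le_mono) simp
      ultimately show ?thesis using that(1) unfolding uv(2) mem_runners by auto
    qed
    then have "is_core 3 xs"
      using is_core_iff_beta_set[OF xs(1), of 3] xs(2) by simp
    then have "xs \<in> C" using size[OF xs(1), of u v] xs uv by (simp add: C)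
    then show "B \<in> beta_set ` C" using xs(2) by blast
  qed
  moreover have "inj_on beta_set C"
    using beta_set_inject by (auto simp: inj_on_def C)
  moreover have "inj_on (\<lambda>(u, v). runners u v) P"
    by (auto simp: inj_on_def runners_inject)
  ultimately have "card C = card P"
    using card_image[of beta_set C] card_image[of "\<lambda>(u, v). runners u v" P] by simp
  then show ?thesis unfolding num_cores_def C_def P_def .
qed

section \<open>The Eisenstein norm form\<close>

text \<open>The norm of \<open>a + b * \<omega>\<close>, where \<open>\<omega>\<^sup>2 + \<omega> + 1 = 0\<close>.\<close>

definition eis_norm :: "int \<Rightarrow> int \<Rightarrow> int" where
  "eis_norm a b = a\<^sup>2 - a * b + b\<^sup>2"

lemma pair_set_eqI: "(\<And>a b. (a, b) \<in> A \<longleftrightarrow> (a, b) \<in> B) \<Longrightarrow> A = B"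
  by auto

definition norm_set :: "nat \<Rightarrow> (int \<times> int) set" where
  "norm_set N = {(a, b). eis_norm a b = int N}"

lemma eis_norm_square: "4 * eis_norm a b = (2 * a - b)\<^sup>2 + 3 * b\<^sup>2"
  by (simp add: eis_norm_def power2_eq_square algebra_simps)

lemma eis_norm_nonneg: "0 \<le> eis_norm a b"
proof -
  have "0 \<le> (2 * a - b)\<^sup>2 + 3 * b\<^sup>2" by simp
  then show ?thesis using eis_norm_square[of a b] by linarith
qed

lemma eis_norm_eq_0_iff: "eis_norm a b = 0 \<longleftrightarrow> a = 0 \<and> b = 0"
proof
  assume "eis_norm a b = 0"
  then have "(2 * a - b)\<^sup>2 + 3 * b\<^sup>2 = 0" using eis_norm_square[of a b] by simp
  moreover have "0 \<le> (2 * a - b)\<^sup>2" "0 \<le> b\<^sup>2" by simp_all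
  ultimately have "b\<^sup>2 = 0" "(2 * a - b)\<^sup>2 = 0" by linarith+
  then show "a = 0 \<and> b = 0" by simp
qed (simp add: eis_norm_def)

lemma eis_norm_scale: "eis_norm (c * a) (c * b) = c\<^sup>2 * eis_norm a b"
  by (simp add: eis_norm_def power2_eq_square algebra_simps)

lemma finite_norm_set: "finite (norm_set N)"
proof (rule finite_subset)
  show "norm_set N \<subseteq> {- 2 * int N..2 * int N} \<times> {- 2 * int N..2 * int N}"
  proof (clarsimp simp: norm_set_def)
    fix a b assume N: "eis_norm a b = int N"
    have "2 * eis_norm a b = a\<^sup>2 + b\<^sup>2 + (a - b)\<^sup>2"
      by (simp add: eis_norm_def power2_eq_square algebra_simps)
    moreover have "0 \<le> a\<^sup>2" "0 \<le> b\<^sup>2" "0 \<le> (a - b)\<^sup>2" by simp_all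
    ultimately have "a\<^sup>2 \<le> 2 * int N" "b\<^sup>2 \<le> 2 * int N" using N by linarith+
    moreover have "\<bar>c\<bar> \<le> c\<^sup>2" for c :: int
      using self_le_power[of "\<bar>c\<bar>" 2] by (cases "c = 0") auto
    ultimately have "\<bar>a\<bar> \<le> 2 * int N" "\<bar>b\<bar> \<le> 2 * int N" by (meson order_trans)+
    then show "- (2 * int N) \<le> a \<and> a \<le> 2 * int N \<and> - (2 * int N) \<le> b \<and> b \<le> 2 * int N"
      by linarith
  qed
qed simp

text \<open>The two inequalities cut out a sector of 120 degrees; its bounding rays are spanned by
  \<open>1 - \<omega>\<close> and \<open>1 + 2 * \<omega>\<close>, whose elements have a norm divisible by 3.\<close>

definition sector :: "nat \<Rightarrow> (int \<times> int) set" where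
  "sector N = {(a, b). eis_norm a b = int N \<and> 0 < a + b \<and> 0 < 2 * a - b \<and> (a + b) mod 3 = 2}"

lemma eis_norm_mod_3: "eis_norm a b mod 3 = ((a + b) mod 3)\<^sup>2 mod 3"
proof -
  have "(a + b)\<^sup>2 = eis_norm a b + 3 * (a * b)"
    by (simp add: eis_norm_def power2_eq_square algebra_simps)
  then have "eis_norm a b mod 3 = (a + b)\<^sup>2 mod 3" by simp
  then show ?thesis by (simp add: power_mod)
qed

lemma eis_norm_rotate: "eis_norm (- b) (a - b) = eis_norm a b"
  by (simp add: eis_norm_def power2_eq_square algebra_simps)

lemma eis_norm_minus: "eis_norm (- a) (- b) = eis_norm a b"
  by (simp add: eis_norm_def)

text \<open>Negation exchanges the two nonzero residues of a + b modulo 3, while multiplication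
  by \<open>\<omega>\<close> preserves the residue and rotates the sector onto the other two thirds of the plane.
  No element lies on a bounding ray, since N is not divisible by 3.\<close>

lemma card_norm_set_sector:
  assumes "N mod 3 = 1"
  shows "card (norm_set N) = 6 * card (sector N)"
proof -
  define T where "T = {(a, b). eis_norm a b = int N \<and> (a + b) mod 3 = 2}"
  \<comment> \<open>multiplication by \<open>\<omega>\<close> and by \<open>\<omega>\<^sup>2\<close>\<close>
  define \<rho> :: "int \<times> int \<Rightarrow> int \<times> int" where "\<rho> = (\<lambda>(a, b). (- b, a - b))"
  define \<sigma> :: "int \<times> int \<Rightarrow> int \<times> int" where "\<sigma> = (\<lambda>(a, b). (b - a, - a))"
  define neg :: "int \<times> int \<Rightarrow> int \<times> int" where "neg = (\<lambda>(a, b). (- a, - b))"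
  have fin: "finite T" "finite (sector N)"
    by (auto simp: T_def sector_def norm_set_def intro!: finite_subset[OF _ finite_norm_set[of N]])
  have mem: "(a, b) \<in> \<rho> ` A \<longleftrightarrow> (b - a, - a) \<in> A"
            "(a, b) \<in> \<sigma> ` A \<longleftrightarrow> (- b, a - b) \<in> A"
            "(a, b) \<in> neg ` A \<longleftrightarrow> (- a, - b) \<in> A" for a b A
    by (force simp: \<rho>_def \<sigma>_def neg_def image_iff)+
  have inj: "inj_on \<rho> A" "inj_on \<sigma> A" "inj_on neg A" for A
    by (auto simp: \<rho>_def \<sigma>_def neg_def inj_on_def)
  have norm_\<sigma>: "eis_norm (b - a) (- a) = eis_norm a b" for a b
    by (simp add: eis_norm_def power2_eq_square algebra_simps)
  have split: "(a, b) \<in> norm_set N \<longleftrightarrow> (a, b) \<in> T \<union> neg ` T" for a b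
  proof -
    have "(a + b) mod 3 = 2 \<or> (- a + - b) mod 3 = 2" if "eis_norm a b = int N"
    proof -
      have "int N mod 3 = 1" using assms by (metis of_nat_1 of_nat_mod of_nat_numeral)
      then have "(a + b) mod 3 \<noteq> 0" using eis_norm_mod_3[of a b] that by auto
      then show ?thesis by presburger
    qed
    then show ?thesis
      unfolding Un_iff mem T_def norm_set_def mem_Collect_eq prod.case eis_norm_minus by blast
  qed
  have "card (norm_set N) = card T + card (neg ` T)"
  proof -
    have "norm_set N = T \<union> neg ` T" by (rule pair_set_eqI) (rule split)
    moreover have "(a, b) \<notin> T \<inter> neg ` T" for a b
    proof -
      have "\<not> ((a + b) mod 3 = 2 \<and> (- a + - b) mod 3 = 2)" by presburger
      then show ?thesis
        unfolding Int_iff mem T_def mem_Collect_eq prod.case by blast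
    qed
    then have "T \<inter> neg ` T = {}" by (intro pair_set_eqI) simp
    ultimately show ?thesis by (simp add: card_Un_disjoint fin)
  qed
  moreover have "card (neg ` T) = card T" by (rule card_image[OF inj(3)])
  moreover have "card T = card (sector N) + card (\<rho> ` sector N) + card (\<sigma> ` sector N)"
  proof -
    have T: "(a, b) \<in> T \<longleftrightarrow> (a, b) \<in> sector N \<or> (a, b) \<in> \<rho> ` sector N \<or> (a, b) \<in> \<sigma> ` sector N"
      for a b
    proof -
      have "(0 < a + b \<and> 0 < 2 * a - b) \<or> (0 < b - 2 * a \<and> 0 < 2 * b - a) \<or>
          (0 < a - 2 * b \<and> 0 < - a - b)" if "(a + b) mod 3 = 2"
      proof -
        have "a + b \<noteq> 0" "2 * a - b \<noteq> 0" "2 * b - a \<noteq> 0" using that by presburger+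
        then show ?thesis by linarith
      qed
      moreover have "(b - 2 * a) mod 3 = 2 \<longleftrightarrow> (a + b) mod 3 = 2"
        "(a - 2 * b) mod 3 = 2 \<longleftrightarrow> (a + b) mod 3 = 2" by presburger+
      moreover have "(b - a) + (- a) = b - 2 * a" "2 * (b - a) - (- a) = 2 * b - a"
        "(- b) + (a - b) = a - 2 * b" "2 * (- b) - (a - b) = - a - b" by simp_all
      ultimately show ?thesis
        unfolding mem T_def sector_def mem_Collect_eq prod.case norm_\<sigma> eis_norm_rotate by metis
    qed
    have disj: "sector N \<inter> \<rho> ` sector N = {}" "(sector N \<union> \<rho> ` sector N) \<inter> \<sigma> ` sector N = {}"
      by (intro pair_set_eqI; simp only: Int_iff Un_iff mem empty_iff; force simp: sector_def)+
    have "T = (sector N \<union> \<rho> ` sector N) \<union> \<sigma> ` sector N"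
      by (rule pair_set_eqI) (simp only: T Un_iff disj_assoc)
    then show ?thesis by (simp add: card_Un_disjoint disj fin)
  qed
  ultimately show ?thesis by (simp add: card_image inj)
qed

text \<open>The map is \<open>\<beta> \<mapsto> (1 - \<omega>) * \<beta> + 1 + \<omega>\<close> for \<open>\<beta> = u + v * \<omega>\<close>. The two inequalities of the
  sector express that u and v are nonnegative.\<close>

lemma card_sector:
  "card (sector (3 * n + 1)) = card {(u, v). u\<^sup>2 + v\<^sup>2 + v = n + u * v}"
proof -
  define P :: "(nat \<times> nat) set" where "P = {(u, v). u\<^sup>2 + v\<^sup>2 + v = n + u * v}"
  define f :: "nat \<times> nat \<Rightarrow> int \<times> int" 
    where "f = (\<lambda>(u, v). (int u + int v + 1, 2 * int v - int u + 1))"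
  have norm: "eis_norm (x + y + 1) (2 * y - x + 1) = 3 * (x\<^sup>2 + y\<^sup>2 + y - x * y) + 1" for x y
    by (simp add: eis_norm_def power2_eq_square algebra_simps)
  have P: "(u, v) \<in> P \<longleftrightarrow> (int u)\<^sup>2 + (int v)\<^sup>2 + int v - int u * int v = int n" for u v
  proof -
    have "(u, v) \<in> P \<longleftrightarrow> int (u\<^sup>2 + v\<^sup>2 + v) = int (n + u * v)"
      unfolding P_def of_nat_eq_iff by simp
    then show ?thesis by (simp add: algebra_simps)
  qed
  have "f ` P = sector (3 * n + 1)"
  proof (intro equalityI subsetI)
    fix z assume "z \<in> f ` P"
    then obtain u v where uv: "(u, v) \<in> P" "z = f (u, v)" by auto
    have "(int u + int v + 1 + (2 * int v - int u + 1)) mod 3 = 2"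
      by presburger
    then show "z \<in> sector (3 * n + 1)"
      using uv P[of u v] norm[of "int u" "int v"] by (simp add: f_def sector_def)
  next
    fix z assume z: "z \<in> sector (3 * n + 1)"
    obtain a b where ab: "z = (a, b)" by force
    have pos: "0 < a + b" "0 < 2 * a - b" and m: "(a + b) mod 3 = 2"
      and N: "eis_norm a b = 3 * int n + 1"
      using z by (auto simp: ab sector_def)
    define y where "y = (a + b) div 3"
    define x where "x = a - 1 - y"
    have y: "a + b = 3 * y + 2" using m unfolding y_def by presburger
    then have ab': "a = x + y + 1" "b = 2 * y - x + 1" by (simp_all add: x_def)
    then have "0 \<le> x" "0 \<le> y" using pos by linarith+
    then obtain u v where uv: "x = int u" "y = int v" by (metis nonneg_int_cases)
    have "(u, v) \<in> P" using N norm[of x y] unfolding P ab' uv by simp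
    then show "z \<in> f ` P"
      by (intro image_eqI[of _ _ "(u, v)"]) (auto simp: f_def ab ab' uv)
  qed
  moreover have "inj_on f P" by (auto simp: inj_on_def f_def)
  ultimately have "card (sector (3 * n + 1)) = card P" using card_image[of f P] by simp
  then show ?thesis unfolding P_def .
qed

lemma fermat_theorem_int:
  fixes p :: nat and x :: int
  assumes "prime p" "\<not> int p dvd x"
  shows "[x ^ (p - 1) = 1] (mod int p)"
proof -
  define y where "y = nat (x mod int p)"
  have y: "int y = x mod int p" using assms(1) by (simp add: y_def prime_gt_0_nat)
  then have "\<not> int p dvd int y" using assms(2) by (simp add: dvd_mod_iff)
  then have "\<not> p dvd y" by simp
  then have "[int (y ^ (p - 1)) = int 1] (mod int p)"
    using fermat_theorem[OF assms(1)] by (simp only: cong_int_iff)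
  then have "[(x mod int p) ^ (p - 1) = 1] (mod int p)" by (simp add: y)
  then show ?thesis by (simp add: cong_def power_mod)
qed

text \<open>Otherwise a and -b are units modulo p with the same cube. As p - 1 is not divisible by
  3, cubing is injective on units: for p = 3 m + 2, equal cubes give equal powers with exponent
  3 m, and Fermat's theorem makes x the inverse of its power with exponent 3 m. So a = -b modulo
  p, and the norm is \<open>3 * a\<^sup>2\<close>, which is not divisible by p.\<close>

lemma inert_dvd_eis_norm:
  fixes p :: nat and a b :: int
  assumes p: "prime p" "p mod 3 = 2" and dvd: "int p dvd eis_norm a b"
  shows "int p dvd a \<and> int p dvd b"
proof (rule ccontr)
  assume neg: "\<not> (int p dvd a \<and> int p dvd b)"
  have prime: "prime (int p)" using p by simp
  have ndvd: "\<not> int p dvd a" "\<not> int p dvd b"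
  proof -
    have *: "int p dvd x" if "int p dvd eis_norm x y" "int p dvd y" for x y
    proof -
      have "x\<^sup>2 = eis_norm x y - y * (y - x)"
        by (simp add: eis_norm_def power2_eq_square algebra_simps)
      then have "int p dvd x\<^sup>2" using that by simp
      then show ?thesis using prime prime_dvd_power by blast
    qed
    have "eis_norm b a = eis_norm a b" by (simp add: eis_norm_def)
    then show "\<not> int p dvd a" "\<not> int p dvd b" using * neg dvd by metis+
  qed
  obtain m where m: "p = 3 * m + 2" using p(2) by (metis mult_div_mod_eq)
  have "a ^ 3 + b ^ 3 = (a + b) * eis_norm a b"
    by (simp add: eis_norm_def power2_eq_square power3_eq_cube algebra_simps)
  then have "int p dvd a ^ 3 - (- b) ^ 3" using dvd by simp
  then have "[a ^ 3 = (- b) ^ 3] (mod int p)" by (simp add: cong_iff_dvd_diff)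
  then have "[(a ^ 3) ^ m = ((- b) ^ 3) ^ m] (mod int p)" by (rule cong_pow)
  then have c1: "[a ^ (3 * m) = (- b) ^ (3 * m)] (mod int p)" by (simp add: power_mult)
  have fermat: "[x ^ (3 * m + 1) = 1] (mod int p)" if "\<not> int p dvd x" for x
  proof -
    have "p - 1 = 3 * m + 1" using m by simp
    then show ?thesis using fermat_theorem_int[OF p(1) that] by simp
  qed
  have "[a ^ (3 * m) * a = 1] (mod int p)" "[(- b) ^ (3 * m) * (- b) = 1] (mod int p)"
    using fermat[of a] fermat[of "- b"] ndvd by (simp_all add: mult.commute)
  then have "[a ^ (3 * m) * a = (- b) ^ (3 * m) * (- b)] (mod int p)"
    by (metis cong_sym cong_trans)
  also have "[(- b) ^ (3 * m) * (- b) = a ^ (3 * m) * (- b)] (mod int p)"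
    by (intro cong_mult cong_refl cong_sym[OF c1])
  finally have "int p dvd a ^ (3 * m) * (a + b)"
    by (simp add: cong_iff_dvd_diff algebra_simps)
  moreover have "\<not> int p dvd a ^ j" for j using prime ndvd(1) prime_dvd_power by blast
  ultimately have "int p dvd a + b" using prime prime_dvd_mult_iff by blast
  moreover have "3 * a\<^sup>2 = eis_norm a b + (a + b) * (2 * a - b)"
    by (simp add: eis_norm_def power2_eq_square algebra_simps)
  ultimately have "int p dvd 3 * a\<^sup>2" using dvd by simp
  then have "int p dvd 3"
    using prime prime_dvd_mult_iff \<open>\<And>j. \<not> int p dvd a ^ j\<close> by blast
  then have "p \<le> 3" by (auto dest: zdvd_imp_le)
  moreover have "p \<noteq> 0" "p \<noteq> 1" using p(1) by auto
  ultimately have "p = 2" using p(2) by presburger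
  then show False using \<open>int p dvd 3\<close> by simp
qed


lemma card_norm_set_inert:
  assumes p: "prime p" "p mod 3 = 2"
  shows "card (norm_set (p\<^sup>2 * N)) = card (norm_set N)"
proof -
  have p0: "int p \<noteq> 0" using p(1) by (simp add: prime_gt_0_nat)
  define f where "f = (\<lambda>(a, b). (int p * a, int p * b))"
  have "f ` norm_set N = norm_set (p\<^sup>2 * N)"
  proof (intro equalityI subsetI)
    fix z assume "z \<in> norm_set (p\<^sup>2 * N)"
    then obtain a b where z: "z = (a, b)" "eis_norm a b = int (p\<^sup>2 * N)"
      by (auto simp: norm_set_def)
    have "int p dvd eis_norm a b" by (simp add: z power2_eq_square)
    then obtain a' b' where ab: "a = int p * a'" "b = int p * b'"
      using inert_dvd_eis_norm[OF p] by (meson dvdE)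
    have "(int p)\<^sup>2 * eis_norm a' b' = (int p)\<^sup>2 * int N"
      using z(2) by (simp add: ab eis_norm_scale)
    then have "(a', b') \<in> norm_set N" using p0 by (simp add: norm_set_def)
    then show "z \<in> f ` norm_set N"
      by (intro image_eqI[of _ _ "(a', b')"]) (auto simp: f_def z ab)
  qed (auto simp: f_def norm_set_def eis_norm_scale)
  moreover have "inj_on f (norm_set N)" using p0 by (auto simp: f_def inj_on_def)
  ultimately show ?thesis by (metis card_image)
qed

text \<open>If g is a primitive root and p = 3 m + 1, then \<open>g ^ m\<close> is a primitive cube root of unity,
  and its negative is the required x.\<close>

lemma exists_primitive_sixth_root:
  assumes p: "prime p" "p mod 3 = 1"
  shows "\<exists>x::int. int p dvd x\<^sup>2 - x + 1"
proof -
  have gt: "p > 1" by (rule prime_gt_1_nat[OF p(1)])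
  obtain g where g: "residue_primroot p g"
    using prime_primitive_root_exists[of p] p(1) gt by auto
  define m where "m = p div 3"
  have m: "p = 3 * m + 1" using p(2) unfolding m_def by presburger
  have "m > 0" using gt m by simp
  have ord: "ord p g = 3 * m" using g m p(1) by (simp add: residue_primroot_def totient_prime)
  define y where "y = g ^ m"
  have "[y ^ 3 = 1] (mod p)"
    using ord_divides[of g "3 * m" p] ord by (simp add: y_def power_mult[symmetric] mult.commute)
  then have "[int (y ^ 3) = int 1] (mod int p)" by (simp only: cong_int_iff)
  then have "int p dvd (int y) ^ 3 - 1" by (simp add: cong_iff_dvd_diff)
  also have "(int y) ^ 3 - 1 = (int y - 1) * ((- int y)\<^sup>2 - (- int y) + 1)"
    by (simp add: power2_eq_square power3_eq_cube algebra_simps)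
  finally have "int p dvd int y - 1 \<or> int p dvd (- int y)\<^sup>2 - (- int y) + 1"
    using p(1) by (simp add: prime_dvd_mult_iff)
  moreover have "\<not> int p dvd int y - 1"
  proof
    assume "int p dvd int y - 1"
    then have "[int y = int 1] (mod int p)" by (simp add: cong_iff_dvd_diff)
    then have "[g ^ m = 1] (mod p)" by (simp only: cong_int_iff y_def)
    then have "3 * m dvd m" using ord_divides[of g m p] ord by simp
    then show False using \<open>m > 0\<close> by (auto dest: dvd_imp_le)
  qed
  ultimately show ?thesis by blast
qed

text \<open>Pigeonhole: there are more than p pairs of natural numbers up to the integer square root
  s of p, so two of them agree in \<open>a - x * b\<close> modulo p. Their difference is bounded by s in both
  coordinates, and \<open>s\<^sup>2\<close> is not p.\<close>

lemma thue_lemma: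
  fixes p :: nat and x :: int
  assumes p: "prime p" 
  shows "\<exists>a b. (a, b) \<noteq> (0, 0) \<and> a\<^sup>2 < int p \<and> b\<^sup>2 < int p \<and> int p dvd a - x * b"
proof -
  define s where "s = floor_sqrt p"
  have s: "s\<^sup>2 \<le> p" "p < (Suc s)\<^sup>2"
    by (simp_all only: s_def floor_sqrt_power2_le Suc_floor_sqrt_power2_gt)
  have "\<not> prime (s\<^sup>2)" by (simp add: prime_power_iff)
  then have "s\<^sup>2 \<noteq> p" using p by metis
  with s(1) have s2: "(int s)\<^sup>2 < int p" by (simp flip: of_nat_power)
  define f where "f = (\<lambda>(a, b). (int a - x * int b) mod int p)"
  define A where "A = {..s} \<times> {..s}"
  have "f ` A \<subseteq> {0..<int p}" using p by (auto simp: f_def prime_gt_0_nat)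
  then have "card (f ` A) \<le> p" using card_mono[of "{0..<int p}"] by fastforce
  also have "p < card A" using s(2) by (simp add: A_def power2_eq_square)
  finally have "\<not> inj_on f A" by (auto dest: card_image)
  then obtain a b a' b' where ab: "(a, b) \<in> A" "(a', b') \<in> A" "(a, b) \<noteq> (a', b')"
      "f (a, b) = f (a', b')"
    unfolding inj_on_def by auto
  have sq: "(int c - int d)\<^sup>2 < int p" if "c \<le> s" "d \<le> s" for c d
  proof -
    have "\<bar>int c - int d\<bar> \<le> \<bar>int s\<bar>" using that by auto
    then have "(int c - int d)\<^sup>2 \<le> (int s)\<^sup>2" by (simp only: abs_le_square_iff)
    then show ?thesis using s2 by (rule order.strict_trans1)
  qed
  have "int p dvd (int a - x * int b) - (int a' - x * int b')"
    using ab(4) by (simp add: f_def mod_eq_dvd_iff)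
  moreover have "(int a - x * int b) - (int a' - x * int b') = (int a - int a') - x * (int b - int b')"
    by (simp add: algebra_simps)
  ultimately have "int p dvd (int a - int a') - x * (int b - int b')" by simp
  moreover have "(int a - int a', int b - int b') \<noteq> (0, 0)" using ab(3) by auto
  moreover have "(int a - int a')\<^sup>2 < int p" "(int b - int b')\<^sup>2 < int p"
    using ab(1,2) by (auto simp: A_def intro!: sq)
  ultimately show ?thesis by blast
qed

text \<open>Thue's lemma for a primitive sixth root of unity x modulo p gives a positive multiple of
  p that is a norm less than 3 p. It is not 2 p, since an even norm comes from even a and b and
  is divisible by 4.\<close>

lemma split_prime_is_norm:
  assumes p: "prime p" "p mod 3 = 1"
  shows "\<exists>c d. eis_norm c d = int p"
proof -
  obtain x :: int where x: "int p dvd x\<^sup>2 - x + 1" using exists_primitive_sixth_root[OF p] by blast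
  obtain a b where ab: "(a, b) \<noteq> (0, 0)" "a\<^sup>2 < int p" "b\<^sup>2 < int p" "int p dvd a - x * b"
    using thue_lemma[OF p(1)] by blast
  have "eis_norm a b = (a - x * b) * (a + x * b - b) + (x\<^sup>2 - x + 1) * b\<^sup>2"
    by (simp add: eis_norm_def power2_eq_square algebra_simps)
  then have "int p dvd eis_norm a b" using x ab(4) by simp
  then obtain k where k: "eis_norm a b = int p * k" by (elim dvdE)
  have p0: "0 < int p" using p(1) by (simp add: prime_gt_0_nat)
  have "2 * eis_norm a b = 3 * a\<^sup>2 + 3 * b\<^sup>2 - (a + b)\<^sup>2"
    by (simp add: eis_norm_def power2_eq_square algebra_simps)
  moreover have "0 \<le> (a + b)\<^sup>2" by simp
  ultimately have "int p * k < int p * 3" using ab(2,3) k by linarith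
  then have "k < 3" using p0 by simp
  moreover have "0 < int p * k"
    using ab(1) k eis_norm_nonneg[of a b] eis_norm_eq_0_iff[of a b] by auto
  then have "0 < k" using p0 by (simp add: zero_less_mult_iff)
  moreover have "k \<noteq> 2"
  proof
    assume "k = 2"
    then have "even (eis_norm a b)" using k by simp
    then have "even a \<and> even b" by (auto simp: eis_norm_def)
    then obtain a' b' where "a = 2 * a'" "b = 2 * b'" by (meson dvdE)
    then have "int p * 2 = 4 * eis_norm a' b'" using k \<open>k = 2\<close> eis_norm_scale[of 2 a' b'] by simp
    then have "even p" by presburger
    then have "p = 2" using p(1) primes_dvd_imp_eq[of 2 p] by simp
    then show False using p(2) by simp
  qed
  ultimately have "k = 1" by linarith
  then show ?thesis using k by auto
qed

text \<open>Multiplication in the basis \<open>1, \<omega>\<close>.\<close>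

definition eis_mult :: "int \<times> int \<Rightarrow> int \<times> int \<Rightarrow> int \<times> int" where
  "eis_mult = (\<lambda>(c, d) (a, b). (c * a - d * b, c * b + d * a - d * b))"

lemma eis_norm_mult:
  "eis_norm (c * a - d * b) (c * b + d * a - d * b) = eis_norm c d * eis_norm a b"
  by (simp add: eis_norm_def power2_eq_square algebra_simps)

text \<open>Let \<open>\<pi>\<close> have norm p. It divides \<open>\<alpha>\<close> iff p divides the product of \<open>\<alpha>\<close> with the conjugate of
  \<open>\<pi>\<close>. If p divides the norm of \<open>\<alpha>\<close>, then it suffices that p divides the \<open>\<omega>\<close>-coordinate of this
  product, because the norm of the product is divisible by \<open>p\<^sup>2\<close>. The product of the two
  \<open>\<omega>\<close>-coordinates that belong to \<open>\<pi>\<close> and to its conjugate is a combination of p and the norm of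
  \<open>\<alpha>\<close>, so at least one of them is divisible by p. If both are, then p divides \<open>\<alpha>\<close>.\<close>

lemma card_norm_set_split:
  assumes p: "prime p" "p mod 3 = 1"
  shows "card (norm_set (p * N)) + (if p dvd N then card (norm_set (N div p)) else 0)
    = 2 * card (norm_set N)"
proof -
  obtain c d where cd: "eis_norm c d = int p" using split_prime_is_norm[OF p] by blast
  have cd': "eis_norm (c - d) (- d) = int p"
    using cd by (simp add: eis_norm_def power2_eq_square algebra_simps)
  have prime: "prime (int p)" using p(1) by simp
  have p0: "0 < int p" using p(1) by (simp add: prime_gt_0_nat)
  have sq_ndvd: "\<not> (int p)\<^sup>2 dvd int p"
  proof
    assume "(int p)\<^sup>2 dvd int p"
    then have "(int p)\<^sup>2 \<le> int p" using p0 by (intro zdvd_imp_le)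
    moreover have "1 < int p" using prime_gt_1_nat[OF p(1)] by simp
    ultimately show False by (simp add: power2_eq_square)
  qed
  have ndvd_d: "\<not> int p dvd d"
  proof
    assume *: "int p dvd d"
    have "c\<^sup>2 = int p + d * (c - d)" using cd by (simp add: eis_norm_def power2_eq_square algebra_simps)
    then have "int p dvd c\<^sup>2" using * by simp
    then have "int p dvd c" using prime prime_dvd_power by blast
    with * obtain c' d' where "c = int p * c'" "d = int p * d'" by (meson dvdE)
    then have "int p = (int p)\<^sup>2 * eis_norm c' d'" using cd by (simp add: eis_norm_scale)
    then have "(int p)\<^sup>2 dvd int p" by (rule dvdI)
    then show False using sq_ndvd by contradiction
  qed
  have ndvd_cd: "\<not> int p dvd 2 * c - d"
  proof
    assume "int p dvd 2 * c - d"
    moreover have "3 * d\<^sup>2 = 4 * int p - (2 * c - d) * (2 * c - d)"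
      using eis_norm_square[of c d] by (simp add: cd power2_eq_square)
    ultimately have "int p dvd 3 * d\<^sup>2" by simp
    moreover have "\<not> int p dvd d\<^sup>2" using prime ndvd_d prime_dvd_power by blast
    ultimately have "int p dvd 3" using prime prime_dvd_mult_iff by blast
    then have "p \<le> 3" by (auto dest: zdvd_imp_le)
    moreover have "p \<noteq> 0" "p \<noteq> 1" using p(1) by auto
    ultimately show False using p(2) by presburger
  qed
  define \<pi> where "\<pi> = eis_mult (c, d)"
  \<comment> \<open>\<open>(c - d) - d * \<omega>\<close> is the conjugate of \<open>c + d * \<omega>\<close>\<close>
  define \<pi>' where "\<pi>' = eis_mult (c - d, - d)"
  have div: "(a, b) \<in> eis_mult (x, y) ` norm_set N"
    if xy: "eis_norm x y = int p" and ab: "eis_norm a b = int p * int N"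
      and dvd: "int p dvd x * b - y * a" for a b x y
  proof -
    \<comment> \<open>the coordinates of the product with the conjugate of \<open>x + y * \<omega>\<close>\<close>
    define u where "u = (x - y) * a + y * b"
    define v where "v = x * b - y * a"
    have uv: "eis_norm u v = int p * (int p * int N)"
    proof -
      have "eis_norm u v = eis_norm x y * eis_norm a b"
        by (simp add: u_def v_def eis_norm_def power2_eq_square algebra_simps)
      then show ?thesis by (simp add: xy ab)
    qed
    have "u\<^sup>2 = eis_norm u v + v * (u - v)"
      by (simp add: eis_norm_def power2_eq_square algebra_simps)
    moreover have "int p dvd v" using dvd by (simp add: v_def)
    ultimately have "int p dvd u\<^sup>2" by (simp add: uv)
    then have "int p dvd u" using prime prime_dvd_power by blast
    with \<open>int p dvd v\<close> obtain u' v' where u': "u = int p * u'" "v = int p * v'"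
      by (meson dvdE)
    have "(int p)\<^sup>2 * eis_norm u' v' = (int p)\<^sup>2 * int N"
      using uv by (simp add: u' eis_norm_scale power2_eq_square)
    then have mem: "(u', v') \<in> norm_set N" using p0 by (simp add: norm_set_def)
    have "int p * (x * u' - y * v') = x * u - y * v"
      "int p * (x * v' + y * u' - y * v') = x * v + y * u - y * v"
      by (simp_all add: u' algebra_simps)
    moreover have "x * u - y * v = eis_norm x y * a" "x * v + y * u - y * v = eis_norm x y * b"
      by (simp_all add: u_def v_def eis_norm_def power2_eq_square algebra_simps)
    ultimately have "a = x * u' - y * v'" "b = x * v' + y * u' - y * v'"
      using p0 xy by simp_all
    then show ?thesis using mem by (intro image_eqI[of _ _ "(u', v')"]) (simp_all add: eis_mult_def)
  qed
  have dvd_iff: "(a, b) \<in> eis_mult (x, y) ` norm_set N \<longleftrightarrow>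
      eis_norm a b = int p * int N \<and> int p dvd x * b - y * a"
    if xy: "eis_norm x y = int p" for a b x y
  proof
    assume "(a, b) \<in> eis_mult (x, y) ` norm_set N"
    then obtain u v where uv: "eis_norm u v = int N" "a = x * u - y * v" "b = x * v + y * u - y * v"
      by (auto simp: norm_set_def eis_mult_def)
    have "eis_norm a b = int p * int N" by (simp add: uv eis_norm_mult xy)
    moreover have "x * b - y * a = eis_norm x y * v"
      by (simp add: uv eis_norm_def power2_eq_square algebra_simps)
    ultimately show "eis_norm a b = int p * int N \<and> int p dvd x * b - y * a" by (simp add: xy)
  qed (use div[OF xy] in blast)
  have union: "norm_set (p * N) = \<pi> ` norm_set N \<union> \<pi>' ` norm_set N"
  proof -
    have "int p dvd c * b - d * a \<or> int p dvd (c - d) * b - (- d) * a"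
      if "eis_norm a b = int p * int N" for a b
    proof -
      have "(c * b - d * a) * ((c - d) * b - (- d) * a) = eis_norm c d * b\<^sup>2 - d\<^sup>2 * eis_norm a b"
        by (simp add: eis_norm_def power2_eq_square algebra_simps)
      then have "int p dvd (c * b - d * a) * ((c - d) * b - (- d) * a)"
        by (simp add: cd that)
      then show ?thesis using prime prime_dvd_mult_iff by blast
    qed
    then have "(a, b) \<in> norm_set (p * N) \<longleftrightarrow> (a, b) \<in> \<pi> ` norm_set N \<union> \<pi>' ` norm_set N" for a b
      unfolding \<pi>_def \<pi>'_def Un_iff dvd_iff[OF cd] dvd_iff[OF cd'] by (auto simp: norm_set_def)
    then show ?thesis by (rule pair_set_eqI)
  qed
  have inter: "card (\<pi> ` norm_set N \<inter> \<pi>' ` norm_set N) =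
      (if p dvd N then card (norm_set (N div p)) else 0)"
  proof -
    have both: "(a, b) \<in> \<pi> ` norm_set N \<inter> \<pi>' ` norm_set N \<longleftrightarrow>
        eis_norm a b = int p * int N \<and> int p dvd a \<and> int p dvd b" for a b
    proof -
      have "int p dvd a \<and> int p dvd b"
        if "int p dvd c * b - d * a" "int p dvd (c - d) * b - (- d) * a"
      proof -
        have "(2 * c - d) * b = (c * b - d * a) + ((c - d) * b - (- d) * a)"
          by (simp add: algebra_simps)
        then have "int p dvd (2 * c - d) * b" using that by (metis dvd_add)
        then have b: "int p dvd b" using prime ndvd_cd by (simp add: prime_dvd_mult_iff)
        have "d * a = c * b - (c * b - d * a)" by simp
        then have "int p dvd d * a" using b that(1) by (metis dvd_diff dvd_mult)
        then show ?thesis using b prime ndvd_d by (simp add: prime_dvd_mult_iff)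
      qed
      then show ?thesis
        unfolding \<pi>_def \<pi>'_def Int_iff dvd_iff[OF cd] dvd_iff[OF cd'] by auto
    qed
    define f where "f = (\<lambda>(a, b). (int p * a, int p * b))"
    show ?thesis
    proof (cases "p dvd N")
      case True
      then have N: "int N = int p * int (N div p)" by (metis dvd_mult_div_cancel of_nat_mult)
      have "(a, b) \<in> f ` norm_set (N div p) \<longleftrightarrow>
        eis_norm a b = int p * int N \<and> int p dvd a \<and> int p dvd b" for a b
      proof
        assume "(a, b) \<in> f ` norm_set (N div p)"
        then show "eis_norm a b = int p * int N \<and> int p dvd a \<and> int p dvd b"
          by (auto simp: f_def norm_set_def eis_norm_scale N power2_eq_square simp del: of_nat_div)
      next
        assume *: "eis_norm a b = int p * int N \<and> int p dvd a \<and> int p dvd b"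
        then obtain a' b' where ab: "a = int p * a'" "b = int p * b'" by (meson dvdE)
        have "(int p)\<^sup>2 * eis_norm a' b' = (int p)\<^sup>2 * int (N div p)"
          using * unfolding ab eis_norm_scale N by (simp add: power2_eq_square)
        then have "(a', b') \<in> norm_set (N div p)" using p0 by (simp add: norm_set_def)
        then show "(a, b) \<in> f ` norm_set (N div p)"
          by (intro image_eqI[of _ _ "(a', b')"]) (auto simp: f_def ab)
      qed
      then have "\<pi> ` norm_set N \<inter> \<pi>' ` norm_set N = f ` norm_set (N div p)"
        by (intro pair_set_eqI) (simp only: both)
      moreover have "inj_on f A" for A using p0 by (auto simp: f_def inj_on_def)
      ultimately show ?thesis using True by (simp add: card_image)
    next
      case False
      have "(a, b) \<notin> \<pi> ` norm_set N \<inter> \<pi>' ` norm_set N" for a b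
      proof
        assume "(a, b) \<in> \<pi> ` norm_set N \<inter> \<pi>' ` norm_set N"
        then have *: "eis_norm a b = int p * int N \<and> int p dvd a \<and> int p dvd b" using both by blast
        then obtain a' b' where ab: "a = int p * a'" "b = int p * b'" by (meson dvdE)
        have "int p * (int p * eis_norm a' b') = int p * int N"
          using * by (simp only: ab eis_norm_scale power2_eq_square mult.assoc)
        then have "int N = int p * eis_norm a' b'" using p0 by (auto dest: sym)
        then have "int p dvd int N" by (rule dvdI)
        then show False using False by simp
      qed
      then have "\<pi> ` norm_set N \<inter> \<pi>' ` norm_set N = {}"
        by (intro pair_set_eqI) (simp only: empty_iff not_False_eq_True)
      then show ?thesis using False by simp
    qed
  qed
  have inj: "inj_on (eis_mult (x, y)) A" if xy: "eis_norm x y = int p" for x y A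
  proof -
    have "(u, v) = (u', v')" if "eis_mult (x, y) (u, v) = eis_mult (x, y) (u', v')" for u v u' v'
    proof -
      have "eis_norm (x * (u - u') - y * (v - v')) (x * (v - v') + y * (u - u') - y * (v - v')) = 0"
        using that by (simp add: eis_mult_def eis_norm_def algebra_simps)
      then have "eis_norm (u - u') (v - v') = 0"
        unfolding eis_norm_mult xy using p0 by simp
      then show ?thesis by (simp add: eis_norm_eq_0_iff)
    qed
    then show ?thesis by (auto simp: inj_on_def)
  qed
  have "card (\<pi> ` norm_set N) + card (\<pi>' ` norm_set N) =
      card (norm_set (p * N)) + card (\<pi> ` norm_set N \<inter> \<pi>' ` norm_set N)"
    unfolding union by (intro card_Un_Int) (simp_all add: finite_norm_set)
  then show ?thesis
    unfolding inter by (simp add: \<pi>_def \<pi>'_def card_image inj cd cd')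
qed

section \<open>Multiplying the norm by an integer prime to 3\<close>

lemma card_norm_set_split_power:
  assumes p: "prime p" "p mod 3 = 1" and "\<not> p dvd M"
  shows "card (norm_set (p ^ e * M)) = (e + 1) * card (norm_set M)"
proof (induction e rule: induct_nat_012)
  case 1
  then show ?case using card_norm_set_split[OF p, of M] assms(3) by simp
next
  case (ge2 e)
  have "p ^ Suc e * M div p = p ^ e * M" "p dvd p ^ Suc e * M"
    using p(1) by (simp_all add: prime_gt_0_nat mult.assoc)
  then have "card (norm_set (p * (p ^ Suc e * M))) + card (norm_set (p ^ e * M)) =
      2 * card (norm_set (p ^ Suc e * M))"
    using card_norm_set_split[OF p, of "p ^ Suc e * M"] by simp
  moreover have "p ^ Suc (Suc e) * M = p * (p ^ Suc e * M)" by simp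
  ultimately show ?case
    unfolding ge2 by (simp add: algebra_simps)
qed simp

lemma card_norm_set_split_mult:
  assumes p: "prime p" "p mod 3 = 1" and "N > 0"
  shows "card (norm_set (p * N)) * (multiplicity p N + 1) =
    card (norm_set N) * (multiplicity p N + 2)"
proof -
  define e where "e = multiplicity p N"
  obtain M where M: "N = p ^ e * M" "\<not> p dvd M"
    unfolding e_def by (rule multiplicity_decompose'[of N p]) (use assms(1,3) in auto)
  have pN: "p * N = p ^ Suc e * M" by (simp add: M(1))
  have "card (norm_set (p * N)) = (Suc e + 1) * card (norm_set M)"
    unfolding pN by (rule card_norm_set_split_power[OF p M(2)])
  moreover have "card (norm_set N) = (e + 1) * card (norm_set M)"
    unfolding M(1) by (rule card_norm_set_split_power[OF p M(2)])
  ultimately show ?thesis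
    unfolding e_def[symmetric] by (simp add: algebra_simps)
qed

text \<open>A fixed finite set P, not the prime factors of k, indexes the product, so that the index
  set stays the same when a prime factor of k is split off.\<close>

lemma card_norm_set_mult:
  fixes k N :: nat
  assumes "N > 0" and P: "finite P" "P \<subseteq> primes_mod3 1"
  assumes "k > 0" "\<not> 3 dvd k"
    and "\<And>p. p \<in> primes_mod3 2 \<Longrightarrow> even (multiplicity p k)"
    and "\<And>p. p \<in> primes_mod3 1 \<Longrightarrow> p dvd k \<Longrightarrow> p \<in> P"
  shows "real (card (norm_set (k * N))) = real (card (norm_set N)) *
    (\<Prod>p\<in>P. real (multiplicity p k + multiplicity p N + 1) / real (multiplicity p N + 1))"
  using assms(4-)
proof (induction k rule: less_induct)
  case (less k)
  define F where "F k = (\<lambda>p. real (multiplicity p k + multiplicity p N + 1) /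
    real (multiplicity p N + 1))" for k
  have primeP: "prime q" if "q \<in> P" for q using P(2) that by (auto simp: primes_mod3_def)
  consider "k = 1" | p where "prime p" "p dvd k"
    using prime_factor_nat by blast
  then show ?case
  proof cases
    case 1
    then show ?thesis by simp
  next
    case (2 p)
    have "p mod 3 \<noteq> 0"
      using 2 less.prems(2) by (metis dvd_trans mod_0_imp_dvd)
    then consider "p mod 3 = 1" | "p mod 3 = 2" by linarith
    then show ?thesis
    proof cases
      case mod1: 1
      obtain k' where k: "k = p * k'" using 2(2) by (elim dvdE)
      have k': "k' > 0" "k' < k"
        using less.prems(1) prime_gt_1_nat[OF 2(1)] unfolding k by auto
      have other: "multiplicity q k = multiplicity q k'" if "prime q" "q \<noteq> p" for q
        using that k' 2(1) less.prems(1) unfolding k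
        by (simp add: prime_elem_multiplicity_mult_distrib prime_multiplicity_other)
      have self: "multiplicity p k = Suc (multiplicity p k')"
        using 2(1) k'(1) unfolding k by (simp add: prime_elem_multiplicity_mult_distrib)
      have "p \<in> P" using less.prems(4)[of p] 2 mod1 by (simp add: primes_mod3_def)
      have IH: "real (card (norm_set (k' * N))) = real (card (norm_set N)) * prod (F k') P"
        unfolding F_def
      proof (rule less.IH)
        show "even (multiplicity q k')" if "q \<in> primes_mod3 2" for q
        proof -
          have "prime q" "q \<noteq> p" using that mod1 by (auto simp: primes_mod3_def)
          then show ?thesis using less.prems(3)[OF that] other[of q] by simp
        qed
      qed (use k' less.prems in \<open>auto simp: k\<close>)
      \<comment> \<open>the ratio for p has numerator e + 1 in the product for k' and e + 2 in the one for k\<close>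
      define e where "e = multiplicity p k' + multiplicity p N"
      have "card (norm_set (p * (k' * N))) * (multiplicity p (k' * N) + 1) =
          card (norm_set (k' * N)) * (multiplicity p (k' * N) + 2)"
        using card_norm_set_split_mult[OF 2(1) mod1] k'(1) assms(1) by simp
      moreover have "multiplicity p (k' * N) = e"
        using 2(1) k'(1) assms(1) by (simp add: e_def prime_elem_multiplicity_mult_distrib)
      ultimately have "card (norm_set (k * N)) * (e + 1) = card (norm_set (k' * N)) * (e + 2)"
        by (simp add: k mult.assoc)
      then have "real (card (norm_set (k * N))) * real (e + 1) =
          real (card (norm_set (k' * N))) * real (e + 2)"
        by (simp only: of_nat_mult[symmetric])
      then have "real (card (norm_set (k * N))) =
          real (card (norm_set (k' * N))) * (real (e + 2) / real (e + 1))"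
        by (simp add: field_simps)
      moreover have "prod (F k) P = prod (F k') P * (real (e + 2) / real (e + 1))"
      proof -
        have "prod (F k) (P - {p}) = prod (F k') (P - {p})"
          by (intro prod.cong) (auto simp: F_def other primeP)
        moreover have "F k p = F k' p * (real (e + 2) / real (e + 1))"
          by (simp add: F_def self e_def)
        ultimately show ?thesis
          using prod.remove[OF P(1) \<open>p \<in> P\<close>, of "F k"] prod.remove[OF P(1) \<open>p \<in> P\<close>, of "F k'"]
          by simp
      qed
      ultimately show ?thesis using IH unfolding F_def[symmetric] by simp
    next
      case mod2: 2
      have "even (multiplicity p k)"
        using less.prems(3)[of p] 2 mod2 by (simp add: primes_mod3_def)
      moreover have "multiplicity p k \<noteq> 0"
        using 2 less.prems(1) by (simp add: prime_multiplicity_gt_zero_iff[symmetric])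
      ultimately have "2 \<le> multiplicity p k" by (auto elim!: evenE)
      then have "p\<^sup>2 dvd k" by (rule multiplicity_dvd')
      then obtain k' where k: "k = p\<^sup>2 * k'" by (elim dvdE)
      have "1 < p\<^sup>2" by (rule one_less_power[OF prime_gt_1_nat[OF 2(1)]]) simp
      then have k': "k' > 0" "k' < k"
        using less.prems(1) unfolding k by auto
      have other: "multiplicity q k = multiplicity q k'" if "prime q" "q \<noteq> p" for q
        using that k' 2(1) less.prems(1) unfolding k
        by (simp add: prime_elem_multiplicity_mult_distrib prime_elem_multiplicity_power_distrib
            prime_multiplicity_other)
      have self: "multiplicity p k = 2 + multiplicity p k'"
        using 2(1) k'(1) unfolding k
        by (simp add: prime_elem_multiplicity_mult_distrib prime_elem_multiplicity_power_distrib)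
      have "real (card (norm_set (k' * N))) = real (card (norm_set N)) * prod (F k') P"
        unfolding F_def
      proof (rule less.IH)
        show "even (multiplicity q k')" if "q \<in> primes_mod3 2" for q
          using less.prems(3)[OF that] other[of q] that self
          by (cases "q = p") (auto simp: primes_mod3_def)
      qed (use k' less.prems in \<open>auto simp: k\<close>)
      moreover have "prod (F k) P = prod (F k') P"
      proof (intro prod.cong refl)
        fix q assume "q \<in> P"
        then have "prime q" "q \<noteq> p" using P(2) mod2 by (auto simp: primes_mod3_def)
        then show "F k q = F k' q" by (simp add: F_def other)
      qed
      moreover have "card (norm_set (k * N)) = card (norm_set (k' * N))"
        using card_norm_set_inert[OF 2(1) mod2, of "k' * N"] by (simp add: k mult.assoc)
      ultimately show ?thesis unfolding F_def[symmetric] by simp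
    qed
  qed
qed

lemma even_multiplicity_part2:
  assumes "k > 0" "is_square (part2 k)" "p \<in> primes_mod3 2"
  shows "even (multiplicity p k)"
proof -
  define B where "B = {q \<in> primes_mod3 2. q ^ multiplicity q k \<noteq> 1}"
  have fin: "finite B" unfolding B_def by (rule finite_support_part2[OF assms(1)])
  have p: "prime p" using assms(3) by (simp add: primes_mod3_def)
  have "part2 k = (\<Prod>q\<in>B. q ^ multiplicity q k)"
    using fin unfolding part2_def prod.G_def B_def by simp
  then have "multiplicity p (part2 k) = (if p \<in> B then multiplicity p k else 0)"
    using multiplicity_prod_prime_powers[OF fin _ p] by (auto simp: B_def primes_mod3_def)
  then have "multiplicity p (part2 k) = multiplicity p k"
    using assms(3) p by (auto simp: B_def)
  moreover obtain r where r: "part2 k = r\<^sup>2" using assms(2) by (elim is_nth_powerE)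
  have "even (multiplicity p (r\<^sup>2))"
    using p by (cases "r = 0") (simp_all add: prime_elem_multiplicity_power_distrib)
  ultimately show ?thesis by (simp add: r)
qed

lemma card_norm_set_num_cores:
  "card (norm_set (3 * n + 1)) = 6 * num_cores 3 n"
proof -
  have "(3 * n + 1) mod 3 = 1" by presburger
  then show ?thesis by (simp only: card_norm_set_sector card_sector num_cores_3_eq)
qed

theorem mainTheorem6:
  fixes n k :: nat
  assumes "n > 0" and "k > 0" and "\<not> 3 dvd k"
    and "is_square (part2 k)"
  shows "real (num_cores 3 (k * n + (k - 1) div 3)) =
    real (num_cores 3 n) *
    prod' (\<lambda>p. real (multiplicity p k + multiplicity p (3 * n + 1) + 1) /
               real (multiplicity p (3 * n + 1) + 1)) (primes_mod3 1)"
proof -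
  define F where "F = (\<lambda>p. real (multiplicity p k + multiplicity p (3 * n + 1) + 1) /
    real (multiplicity p (3 * n + 1) + 1))"
  define P where "P = {p \<in> prime_factors k. p mod 3 = 1}"
  define S where "S = {p \<in> primes_mod3 1. F p \<noteq> 1}"
  have "k mod 3 = 1" by (rule mod3_eq_1) fact+
  then have "3 * ((k - 1) div 3) + 1 = k" by presburger
  then have N: "k * (3 * n + 1) = 3 * (k * n + (k - 1) div 3) + 1"
    by (simp add: algebra_simps)
  have "real (card (norm_set (k * (3 * n + 1)))) = real (card (norm_set (3 * n + 1))) * prod F P"
    unfolding F_def
    by (rule card_norm_set_mult)
      (use assms in \<open>auto simp: P_def primes_mod3_def in_prime_factors_iff
        intro: even_multiplicity_part2[unfolded primes_mod3_def]\<close>)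
  then have "real (num_cores 3 (k * n + (k - 1) div 3)) = real (num_cores 3 n) * prod F P"
    unfolding N card_norm_set_num_cores by simp
  moreover have "prod' F (primes_mod3 1) = prod F P"
  proof -
    have "finite S"
      using finite_support_ratio[OF assms(2)] by (simp add: S_def F_def)
    then have "prod' F (primes_mod3 1) = prod F S"
      by (simp add: prod.G_def S_def)
    also have "\<dots> = prod F P"
    proof (rule prod.mono_neutral_left)
      show "S \<subseteq> P" 
        using assms(2) by (auto simp: S_def P_def F_def primes_mod3_def prime_factors_multiplicity)
      show "\<forall>p \<in> P - S. F p = 1"
        by (auto simp: S_def P_def primes_mod3_def)
    qed (simp add: P_def)
    finally show ?thesis .
  qed
  ultimately show ?thesis unfolding F_def by simp
qed

end
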